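(* Let $n\ge 0$ be an integer. The matchings of $[2n]$ with no left-nestings are in bijection with the inversion tables of length $n$, and thus the number of matchings of $[2n]$ with no left-nestings is $n!$.
   Context: $[m]=\{1,\dots,m\}$. A matching of $[2n]$ is a partition of $[2n]$ into blocks of size $2$; the blocks are called arcs and written $(i,j)$ with $i<j$. A nesting of a matching $M$ is a pair of arcs $(i,\ell)$ and $(j,k)$ of $M$ with $i<j<k<\ell$; it is a left-nesting if $j=i+1$. An inversion table of length $n$ is an element of the Cartesian product $[0,0]\times[0,1]\times\dots\times[0,n-1]$, where $[i,j]=\{i,i+1,\dots,j\}$; i.e. an integer sequence $(a_1,\dots,a_n)$ with $0\le a_i\le i-1$ for all $i$. *)

theory Defs
  imports Complex_Main "HOL-Library.Disjoint_Sets" "HOL-Library.FuncSet"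
begin

definition matching :: "nat \<Rightarrow> nat set set \<Rightarrow> bool" where
  "matching n M \<longleftrightarrow> partition_on {1..2 * n} M \<and> (\<forall>B\<in>M. card B = 2)"

definition arcs :: "nat set set \<Rightarrow> (nat \<times> nat) set" where
  "arcs M = {(i, j). i < j \<and> {i, j} \<in> M}"

text \<open>The first argument pair is the enclosing arc, the second one the enclosed arc.\<close>

definition nesting :: "nat set set \<Rightarrow> nat \<times> nat \<Rightarrow> nat \<times> nat \<Rightarrow> bool" where
  "nesting M a b \<longleftrightarrow> a \<in> arcs M \<and> b \<in> arcs M \<and>
     fst a < fst b \<and> fst b < snd b \<and> snd b < snd a"

definition left_nesting :: "nat set set \<Rightarrow> nat \<times> nat \<Rightarrow> nat \<times> nat \<Rightarrow> bool" where
  "left_nesting M a b \<longleftrightarrow> nesting M a b \<and> fst b = fst a + 1"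

definition matchings_no_left_nesting :: "nat \<Rightarrow> nat set set set" where
  "matchings_no_left_nesting n = {M. matching n M \<and> \<not> (\<exists>a b. left_nesting M a b)}"

text \<open>Sequences \<open>(a\<^sub>1, \<dots>, a\<^sub>n)\<close> are functions on \<open>{1..n}\<close>, extended by \<open>undefined\<close>;
  the subtraction does not truncate there, since the index is at least 1.\<close>

definition inversion_tables :: "nat \<Rightarrow> (nat \<Rightarrow> nat) set" where
  "inversion_tables n = (\<Pi>\<^sub>E i\<in>{1..n}. {0..i - 1})"

end

theory Submission
  imports Defs
begin

text \<open>
  The number of matchings of \<open>[2n]\<close> without left-nestings satisfies the recursion of the factorial,
  \<open>c (n + 1) = (n + 1) * c n\<close>; the bijection with the inversion tables then exists because
  those are counted by \<open>1 * 2 * \<dots> * n\<close> as well.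

  For the recursion, remove from a matching of \<open>[2n + 2]\<close> the arc \<open>(x, 2n + 2)\<close> that ends at the last
  point and renumber the points. This is reversible: every matching of \<open>[2n + 2]\<close> arises from
  exactly one matching \<open>M\<close> of \<open>[2n]\<close> and one \<open>x \<in> [2n + 1]\<close> by making room for a new point \<open>x\<close> and
  joining it to \<open>2n + 2\<close> (\<open>matching_Suc_cases\<close>, \<open>insert_arc_inject\<close>). A left-nesting consists of
  two neighbouring openers whose partners are in decreasing order. The new arc ends last, so it
  is never the enclosed arc of a nesting, and it is the enclosing arc of a left-nesting exactly
  if \<open>x\<close> is followed by an opener. So the result has no left-nesting only if the new point is placed
  immediately before a closer of \<open>M\<close> or at the very end. Conversely, such a placement creates no
  left-nesting, and it cannot destroy one either: it would have to separate two neighbouring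
  openers, and then it would not come before a closer (\<open>left_nesting_insert_arc_iff\<close>). Since \<open>M\<close> has
  \<open>n\<close> closers, there are always \<open>n + 1\<close> admissible positions, whatever \<open>M\<close> is
  (\<open>bij_betw_insert_arc\<close>, \<open>card_closers\<close>).
\<close>

section \<open>Arcs, openers and closers of a matching\<close>

lemma matching_eqI:
  assumes "matching n M" "B \<in> M" "C \<in> M" "a \<in> B" "a \<in> C"
  shows "B = C"
  using assms unfolding matching_def partition_on_def disjoint_def by blast

lemma matching_blockE:
  assumes "matching n M" "B \<in> M"
  obtains i j where "B = {i, j}" "i < j" "i \<in> {1..2 * n}" "j \<in> {1..2 * n}"
proof -
  have "card B = 2" "B \<subseteq> {1..2 * n}"
    using assms unfolding matching_def partition_on_def by blast+
  then obtain a b where ab: "B = {a, b}" "a \<noteq> b"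
    by (meson card_2_iff)
  show thesis
  proof (cases "a < b")
    case True
    with ab \<open>B \<subseteq> _\<close> show thesis by (intro that[of a b]) auto
  next
    case False
    with ab \<open>B \<subseteq> _\<close> show thesis by (intro that[of b a]) auto
  qed
qed

lemma matching_pointE:
  assumes "matching n M" "k \<in> {1..2 * n}"
  obtains l where "(k, l) \<in> arcs M" | i where "(i, k) \<in> arcs M"
proof -
  obtain B where B: "B \<in> M" "k \<in> B"
    using assms unfolding matching_def partition_on_def by blast
  obtain i j where "B = {i, j}" "i < j"
    using matching_blockE[OF assms(1) B(1)] .
  with B that show thesis
    unfolding arcs_def by auto
qed

lemma arcs_range:
  assumes "matching n M" "(i, j) \<in> arcs M"
  shows "1 \<le> i" "i < j" "j \<le> 2 * n"
proof -
  have "i < j" "{i, j} \<subseteq> {1..2 * n}"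
    using assms partition_onD1 unfolding matching_def arcs_def by blast+
  then show "1 \<le> i" "i < j" "j \<le> 2 * n" by auto
qed

lemma ex_left_nesting_iff:
  "(\<exists>a b. left_nesting M a b) \<longleftrightarrow> (\<exists>i j l. (i, l) \<in> arcs M \<and> (Suc i, j) \<in> arcs M \<and> j < l)"
  by (auto simp: left_nesting_def nesting_def arcs_def)

definition closers :: "nat set set \<Rightarrow> nat set" where
  "closers M = snd ` arcs M"

lemma closers_subset:
  assumes "matching n M"
  shows "closers M \<subseteq> {1..2 * n}"
proof
  fix k assume "k \<in> closers M"
  then obtain i where "(i, k) \<in> arcs M" unfolding closers_def by auto
  from arcs_range[OF assms this] show "k \<in> {1..2 * n}" by simp
qed

lemma opener_not_closer:
  assumes "matching n M" "(k, l) \<in> arcs M"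
  shows "k \<notin> closers M"
proof
  assume "k \<in> closers M"
  then obtain i where i: "(i, k) \<in> arcs M" unfolding closers_def by auto
  with assms have "{i, k} = {k, l}"
    using matching_eqI[OF assms(1), of "{i, k}" "{k, l}" k] by (auto simp: arcs_def)
  with i assms(2) show False by (auto simp: arcs_def doubleton_eq_iff)
qed

lemma card_matching:
  assumes "matching n M"
  shows "finite M" "card M = n"
proof -
  have M: "partition_on {1..2 * n} M" "\<And>B. B \<in> M \<Longrightarrow> card B = 2"
    using assms unfolding matching_def by auto
  show "finite M"
    using M(1) by (rule finite_elements[rotated]) simp
  have "card (\<Union>M) = sum card M"
    using M by (intro card_Union_disjoint)
      (auto simp: partition_on_def disjoint_def pairwise_def disjnt_def intro: card_ge_0_finite)
  also have "\<dots> = 2 * card M" using M(2) by simp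
  finally show "card M = n"
    using M(1) by (simp add: partition_on_def)
qed

text \<open>Each arc has exactly one closer, the maximum of its block.\<close>

lemma card_closers:
  assumes "matching n M"
  shows "card (closers M) = n"
proof -
  have "closers M = Max ` M"
  proof (intro equalityI subsetI)
    fix k assume "k \<in> closers M"
    then obtain i where "i < k" "{i, k} \<in> M" unfolding closers_def arcs_def by auto
    then show "k \<in> Max ` M" by (intro image_eqI[of _ _ "{i, k}"]) auto
  next
    fix k assume "k \<in> Max ` M"
    then obtain B where B: "B \<in> M" "k = Max B" by auto
    obtain i j where "B = {i, j}" "i < j"
      using matching_blockE[OF assms B(1)] .
    with B show "k \<in> closers M" unfolding closers_def arcs_def by force
  qed
  moreover have "inj_on Max M"
  proof (rule inj_onI)
    fix B C assume BC: "B \<in> M" "C \<in> M" "Max B = Max C"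
    have "Max D \<in> D" if "D \<in> M" for D
      using matching_blockE[OF assms that] by (metis Max_in finite.emptyI finite.insertI insert_not_empty)
    with BC show "B = C" using matching_eqI[OF assms] by metis
  qed
  ultimately show ?thesis
    using card_matching[OF assms] by (simp add: card_image)
qed

section \<open>Inserting an arc that ends at the last point\<close>

text \<open>The increasing enumeration of all naturals except \<open>x\<close>; it renumbers the points of a matching
  so that \<open>x\<close> becomes free.\<close>

definition skip :: "nat \<Rightarrow> nat \<Rightarrow> nat" where
  "skip x k = (if k < x then k else Suc k)"

lemma skip_less_iff [simp]: "skip x i < skip x j \<longleftrightarrow> i < j"
  by (auto simp: skip_def)

lemma skip_eq_iff [simp]: "skip x i = skip x j \<longleftrightarrow> i = j"
  by (auto simp: skip_def)

lemma skip_neq [simp]: "skip x i \<noteq> x"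
  by (auto simp: skip_def)

lemma inj_skip: "inj (skip x)"
  by (simp add: inj_on_def)

lemma image_skip:
  assumes "x \<in> {1..2 * n + 1}"
  shows "skip x ` {1..2 * n} = {1..2 * n + 1} - {x}"
proof (intro equalityI subsetI)
  fix k assume k: "k \<in> {1..2 * n + 1} - {x}"
  show "k \<in> skip x ` {1..2 * n}"
  proof (cases "k < x")
    case True
    with k assms show ?thesis by (intro image_eqI[of _ _ k]) (auto simp: skip_def)
  next
    case False
    with k assms show ?thesis by (intro image_eqI[of _ _ "k - 1"]) (auto simp: skip_def)
  qed
qed (use assms in \<open>auto simp: skip_def\<close>)

definition insert_arc :: "nat \<Rightarrow> nat \<Rightarrow> nat set set \<Rightarrow> nat set set" where
  "insert_arc n x M = insert {x, 2 * n + 2} ((`) (skip x) ` M)"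

lemma matching_insert_arc:
  assumes "matching n M" "x \<in> {1..2 * n + 1}"
  shows "matching (Suc n) (insert_arc n x M)"
proof -
  have M: "\<Union>M = {1..2 * n}" "{} \<notin> M" "disjoint M" "\<And>B. B \<in> M \<Longrightarrow> card B = 2"
    using assms(1) unfolding matching_def partition_on_def by auto
  have U: "\<Union>((`) (skip x) ` M) = {1..2 * n + 1} - {x}"
    using image_skip[OF assms(2)] M(1) by (metis image_Union)
  have "disjoint ((`) (skip x) ` M)"
    using M(3) by (fastforce simp: disjoint_def)
  with M(2) U have "partition_on ({1..2 * n + 1} - {x}) ((`) (skip x) ` M)"
    unfolding partition_on_def by auto
  moreover have "disjnt {x, 2 * n + 2} (\<Union>((`) (skip x) ` M))"
    unfolding U by (auto simp: disjnt_def)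
  moreover have "{1..2 * Suc n} - {x, 2 * n + 2} = {1..2 * n + 1} - {x}" "{x, 2 * n + 2} \<subseteq> {1..2 * Suc n}"
    using assms(2) by auto
  ultimately have "partition_on {1..2 * Suc n} (insert_arc n x M)"
    unfolding insert_arc_def by (subst partition_on_insert) (simp_all only:, simp)
  moreover have "card (skip x ` B) = 2" if "B \<in> M" for B
    using M(4)[OF that] by (simp add: card_image inj_on_def)
  ultimately show ?thesis
    using assms(2) unfolding matching_def insert_arc_def by auto
qed

text \<open>The point \<open>2n + 2\<close> has a partner \<open>x\<close>. All other blocks avoid both points, so they lie in the range
  of \<open>skip x\<close> and can be pulled back to blocks on \<open>[2n]\<close>.\<close>

lemma matching_Suc_cases:
  assumes "matching (Suc n) N"
  obtains x M where "x \<in> {1..2 * n + 1}" "matching n M" "N = insert_arc n x M"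
proof -
  have N: "\<Union>N = {1..2 * Suc n}" "{} \<notin> N" "disjoint N" "\<And>B. B \<in> N \<Longrightarrow> card B = 2"
    using assms unfolding matching_def partition_on_def by auto
  obtain L where L: "L \<in> N" "2 * n + 2 \<in> L"
  proof -
    have "2 * n + 2 \<in> \<Union>N" unfolding N(1) by simp
    then show thesis using that by blast
  qed
  obtain x y where "L = {x, y}" "x < y" "x \<in> {1..2 * Suc n}" "y \<in> {1..2 * Suc n}"
    using matching_blockE[OF assms L(1)] .
  with L have x: "L = {x, 2 * n + 2}" "x \<in> {1..2 * n + 1}" by auto
  define M where "M = (`) (skip x) -` N"
  have old: "\<exists>C. C \<subseteq> {1..2 * n} \<and> B = skip x ` C" if "B \<in> N" "B \<noteq> L" for B
  proof -
    have "B \<inter> L = {}" using that L(1) N(3) unfolding disjoint_def by blast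
    moreover have "B \<subseteq> {1..2 * Suc n}" using that(1) N(1) by blast
    moreover have "{1..2 * Suc n} - L = {1..2 * n + 1} - {x}" using x by auto
    ultimately have "B \<subseteq> {1..2 * n + 1} - {x}" by blast
    then show ?thesis
      unfolding image_skip[OF x(2), symmetric] by (meson subset_imageE)
  qed
  have new: "skip x ` C \<noteq> L" for C
    unfolding x(1) by (metis imageE insertI1 skip_neq)
  have N_eq: "N = insert_arc n x M"
  proof (intro equalityI subsetI)
    fix B assume "B \<in> N"
    then show "B \<in> insert_arc n x M"
      using old[of B] x(1) unfolding insert_arc_def M_def by (cases "B = L") auto
  next
    fix B assume "B \<in> insert_arc n x M"
    then show "B \<in> N" using L(1) x(1) unfolding insert_arc_def M_def by auto
  qed
  have M_sub: "C \<subseteq> {1..2 * n}" if "C \<in> M" for C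
  proof -
    from that new[of C] obtain C' where "C' \<subseteq> {1..2 * n}" "skip x ` C = skip x ` C'"
      using old[of "skip x ` C"] unfolding M_def by auto
    then show ?thesis by (simp add: inj_image_eq_iff[OF inj_skip])
  qed
  have "\<exists>C\<in>M. k \<in> C" if "k \<in> {1..2 * n}" for k
  proof -
    have k: "skip x k \<in> {1..2 * n + 1} - {x}"
      using image_skip[OF x(2)] that by blast
    then have "skip x k \<in> \<Union>N" unfolding N(1) by auto
    then obtain B where B: "B \<in> N" "skip x k \<in> B" by auto
    with k have "B \<noteq> L" unfolding x(1) by auto
    with old[OF B(1)] obtain C where "B = skip x ` C" by blast
    with B show ?thesis unfolding M_def by auto
  qed
  with M_sub have "\<Union>M = {1..2 * n}" by blast
  moreover have "{} \<notin> M" using N(2) unfolding M_def by auto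
  moreover have "disjoint M"
    unfolding disjoint_def
  proof (intro ballI impI)
    fix C D assume "C \<in> M" "D \<in> M" "C \<noteq> D"
    then have "skip x ` C \<in> N" "skip x ` D \<in> N" "skip x ` C \<noteq> skip x ` D"
      unfolding M_def by (auto simp: inj_image_eq_iff[OF inj_skip])
    then have "skip x ` C \<inter> skip x ` D = {}"
      using N(3) unfolding disjoint_def by blast
    then show "C \<inter> D = {}" by auto
  qed
  moreover have "card C = 2" if "C \<in> M" for C
    using N(4)[of "skip x ` C"] that
    by (simp add: M_def card_image inj_on_def)
  ultimately have "matching n M"
    unfolding matching_def partition_on_def by blast
  with x(2) N_eq show thesis by (intro that)
qed

text \<open>Both data can be read off the result: \<open>x\<close> is the partner of \<open>2n + 2\<close>, and \<open>M\<close> is the preimage under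
  \<open>skip x\<close>, because the new block contains \<open>x\<close> and hence is not an image under \<open>skip x\<close>.\<close>

lemma insert_arc_inject:
  assumes "matching n M" "x \<in> {1..2 * n + 1}" "matching n M'" "x' \<in> {1..2 * n + 1}"
    and eq: "insert_arc n x M = insert_arc n x' M'"
  shows "M = M' \<and> x = x'"
proof -
  have "{x, 2 * n + 2} = {x', 2 * n + 2}"
  proof (rule matching_eqI[OF matching_insert_arc[OF assms(1,2)], where a = "2 * n + 2"])
    show "{x', 2 * n + 2} \<in> insert_arc n x M"
      unfolding eq by (simp add: insert_arc_def)
  qed (auto simp: insert_arc_def)
  then have "x \<in> {x', 2 * n + 2}" by blast
  then have x: "x = x'" using assms(2) by auto
  have vimage: "(`) (skip y) -` insert_arc n y K = K" for y K
  proof -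
    have "skip y ` C \<noteq> {y, 2 * n + 2}" for C
      by (metis imageE insertI1 skip_neq)
    then show ?thesis
      unfolding insert_arc_def by (auto simp: inj_image_eq_iff[OF inj_skip])
  qed
  show ?thesis using vimage[of x M] vimage[of x' M'] eq x by metis
qed

lemma arcs_insert_arc:
  assumes "x \<in> {1..2 * n + 1}"
  shows "arcs (insert_arc n x M) = insert (x, 2 * n + 2) (map_prod (skip x) (skip x) ` arcs M)"
proof (intro equalityI subrelI)
  fix i j assume "(i, j) \<in> arcs (insert_arc n x M)"
  then have ij: "i < j" "{i, j} = {x, 2 * n + 2} \<or> (\<exists>C\<in>M. {i, j} = skip x ` C)"
    unfolding arcs_def insert_arc_def by auto
  from ij(2) show "(i, j) \<in> insert (x, 2 * n + 2) (map_prod (skip x) (skip x) ` arcs M)"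
  proof
    assume "{i, j} = {x, 2 * n + 2}"
    with ij(1) assms show ?thesis by (auto simp: doubleton_eq_iff)
  next
    assume "\<exists>C\<in>M. {i, j} = skip x ` C"
    then obtain C where C: "C \<in> M" "{i, j} = skip x ` C" by auto
    then obtain a b where ab: "i = skip x a" "j = skip x b" by (metis imageE insertI1 insertI2)
    with C have "skip x ` {a, b} = skip x ` C" by simp
    then have "C = {a, b}" by (simp only: inj_image_eq_iff[OF inj_skip])
    with C ab ij(1) show ?thesis by (auto simp: arcs_def)
  qed
next
  fix i j assume "(i, j) \<in> insert (x, 2 * n + 2) (map_prod (skip x) (skip x) ` arcs M)"
  then show "(i, j) \<in> arcs (insert_arc n x M)"
  proof
    assume "(i, j) = (x, 2 * n + 2)"
    with assms show ?thesis by (auto simp: arcs_def insert_arc_def)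
  next
    assume "(i, j) \<in> map_prod (skip x) (skip x) ` arcs M"
    then obtain a b where "i = skip x a" "j = skip x b" "a < b" "{a, b} \<in> M"
      unfolding arcs_def by auto
    then have "i < j" "{i, j} = skip x ` {a, b}" "{a, b} \<in> M" by auto
    then show ?thesis unfolding arcs_def insert_arc_def by blast
  qed
qed

text \<open>The positions that keep a matching free of left-nestings, with \<open>x\<close> naming both the new point and
  the old point that moves up to \<open>x + 1\<close> to make room for it. If that old point is an opener, its arc is
  left-nested in the new one. The openers of a left-nesting stay neighbours unless
  the new point comes between them, and in that case the second of them is the old point \<open>x\<close>.\<close>

lemma left_nesting_insert_arc_iff:
  assumes M: "matching n M" and x: "x \<in> {1..2 * n + 1}"
  shows "(\<exists>a b. left_nesting (insert_arc n x M) a b) \<longleftrightarrow>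
    (\<exists>a b. left_nesting M a b) \<or> x \<notin> insert (2 * n + 1) (closers M)"
    (is "?L \<longleftrightarrow> ?R \<or> ?bad")
proof
  assume ?L
  then obtain i j l where arcs: "(i, l) \<in> arcs (insert_arc n x M)"
      "(Suc i, j) \<in> arcs (insert_arc n x M)" "j < l"
    unfolding ex_left_nesting_iff by blast
  \<comment> \<open>The enclosed arc does not end at the last point, so it is not the new one.\<close>
  have "j \<le> 2 * n + 1"
    using arcs(3) arcs_range(3)[OF matching_insert_arc[OF M x] arcs(1)] by simp
  with arcs(2) obtain b j' where b: "Suc i = skip x b" "j = skip x j'" "(b, j') \<in> arcs M"
    unfolding arcs_insert_arc[OF x] by auto
  from arcs(1) consider "i = x" | a l' where "i = skip x a" "l = skip x l'" "(a, l') \<in> arcs M"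
    unfolding arcs_insert_arc[OF x] by auto
  then show "?R \<or> ?bad"
  proof cases
    case 1
    with b(1) have "b = x" by (auto simp: skip_def split: if_splits)
    with b(3) opener_not_closer[OF M] arcs_range[OF M b(3)] show ?thesis by auto
  next
    case 2
    with b(1) have "b = Suc a" by (auto simp: skip_def split: if_splits)
    with 2 b arcs(3) have ?R unfolding ex_left_nesting_iff by auto
    then show ?thesis ..
  qed
next
  have new: "(x, 2 * n + 2) \<in> arcs (insert_arc n x M)"
    by (simp add: arcs_insert_arc[OF x])
  have old: "(skip x a, skip x b) \<in> arcs (insert_arc n x M)" if "(a, b) \<in> arcs M" for a b
    using that by (force simp: arcs_insert_arc[OF x])
  have opener: ?L if b: "(x, b) \<in> arcs M" for b
  proof -
    have "(Suc x, skip x b) \<in> arcs (insert_arc n x M)"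
      using old[OF b] by (simp add: skip_def)
    moreover have "skip x b < 2 * n + 2"
      using arcs_range(3)[OF M b] by (simp add: skip_def)
    ultimately show ?L using new unfolding ex_left_nesting_iff by blast
  qed
  assume "?R \<or> ?bad"
  then show ?L
  proof
    assume ?R
    then obtain i j l where ijl: "(i, l) \<in> arcs M" "(Suc i, j) \<in> arcs M" "j < l"
      unfolding ex_left_nesting_iff by blast
    show ?L
    proof (cases "x = Suc i")
      case True
      with ijl(2) show ?L by (intro opener) simp
    next
      case False
      then have "skip x (Suc i) = Suc (skip x i)" by (auto simp: skip_def)
      with old[OF ijl(1)] old[OF ijl(2)] ijl(3) show ?L
        unfolding ex_left_nesting_iff by (metis skip_less_iff)
    qed
  next
    assume ?bad
    with x have "x \<in> {1..2 * n}" "x \<notin> closers M" by auto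
    with matching_pointE[OF M] obtain b where "(x, b) \<in> arcs M"
      unfolding closers_def by (metis image_eqI snd_conv)
    then show ?L by (rule opener)
  qed
qed

section \<open>Counting\<close>

lemma finite_matchings_no_left_nesting: "finite (matchings_no_left_nesting n)"
proof (rule finite_subset)
  show "matchings_no_left_nesting n \<subseteq> Pow (Pow {1..2 * n})"
  proof
    fix M assume "M \<in> matchings_no_left_nesting n"
    then have "\<Union>M = {1..2 * n}"
      by (simp add: matchings_no_left_nesting_def matching_def partition_on_def)
    then show "M \<in> Pow (Pow {1..2 * n})" by auto
  qed
qed simp

lemma bij_betw_insert_arc:
  "bij_betw (\<lambda>(M, x). insert_arc n x M)
    (SIGMA M:matchings_no_left_nesting n. insert (2 * n + 1) (closers M))
    (matchings_no_left_nesting (Suc n))"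
  (is "bij_betw ?f ?S ?T")
proof (rule bij_betw_imageI)
  have range: "matching n M \<and> x \<in> {1..2 * n + 1}" if "(M, x) \<in> ?S" for M x
  proof -
    have "matching n M" "x = 2 * n + 1 \<or> x \<in> closers M"
      using that by (simp_all add: matchings_no_left_nesting_def)
    then show ?thesis using closers_subset[of n M] by auto
  qed
  have mem_iff: "insert_arc n x M \<in> ?T \<longleftrightarrow> (M, x) \<in> ?S"
    if M: "matching n M" and x: "x \<in> {1..2 * n + 1}" for M x
    using matching_insert_arc[OF M x] M left_nesting_insert_arc_iff[OF M x]
    by (simp only: matchings_no_left_nesting_def mem_Collect_eq mem_Sigma_iff de_Morgan_disj not_not simp_thms)
  show "inj_on ?f ?S"
  proof (rule inj_onI)
    fix p p' assume p: "p \<in> ?S" "p' \<in> ?S" "?f p = ?f p'"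
    obtain M x M' x' where Mx: "p = (M, x)" "p' = (M', x')" by (meson prod.exhaust)
    have "matching n M" "x \<in> {1..2 * n + 1}" "matching n M'" "x' \<in> {1..2 * n + 1}"
      using range p(1,2) unfolding Mx by metis+
    moreover have "insert_arc n x M = insert_arc n x' M'"
      using p(3) by (simp only: Mx prod.case)
    ultimately have "M = M' \<and> x = x'" by (rule insert_arc_inject)
    then show "p = p'" by (simp only: Mx)
  qed
  show "?f ` ?S = ?T"
  proof (rule equalityI; rule subsetI)
    fix N assume "N \<in> ?f ` ?S"
    then obtain p where p: "N = ?f p" "p \<in> ?S" by (rule imageE)
    obtain M x where "p = (M, x)" by (rule prod.exhaust)
    with p have "N = insert_arc n x M" "(M, x) \<in> ?S" by (simp_all only: prod.case)
    with range mem_iff show "N \<in> ?T" by metis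
  next
    fix N assume "N \<in> ?T"
    then have "matching (Suc n) N"
      by (simp only: matchings_no_left_nesting_def mem_Collect_eq)
    then obtain x M where xM: "x \<in> {1..2 * n + 1}" "matching n M" "N = insert_arc n x M"
      using matching_Suc_cases by metis
    with \<open>N \<in> ?T\<close> mem_iff have "(M, x) \<in> ?S" by metis
    then show "N \<in> ?f ` ?S"
      using xM(3) by (intro image_eqI[of _ _ "(M, x)"]) (simp_all only: prod.case)
  qed
qed

text \<open>In the domain of the bijection \<open>bij_betw_insert_arc\<close>, every \<open>M\<close> is paired with \<open>n + 1\<close> positions: the \<open>n\<close> closers of \<open>M\<close>, and the position \<open>2n + 1\<close> at the end.\<close>

lemma card_matchings_no_left_nesting: "card (matchings_no_left_nesting n) = fact n"
proof (induction n)
  case 0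
  have "matchings_no_left_nesting 0 = {{}}"
    unfolding matchings_no_left_nesting_def ex_left_nesting_iff
    by (auto simp: matching_def partition_on_def arcs_def)
  then show ?case by simp
next
  case (Suc n)
  have "finite (insert (2 * n + 1) (closers M)) \<and> card (insert (2 * n + 1) (closers M)) = Suc n"
    if "M \<in> matchings_no_left_nesting n" for M
  proof -
    have M: "matching n M" using that unfolding matchings_no_left_nesting_def by blast
    have "finite (closers M)"
      using closers_subset[OF M] by (rule finite_subset) simp
    moreover have "2 * n + 1 \<notin> closers M"
      using closers_subset[OF M] by auto
    ultimately show ?thesis by (simp add: card_closers[OF M])
  qed
  then have "card (matchings_no_left_nesting (Suc n)) = (\<Sum>M\<in>matchings_no_left_nesting n. Suc n)"
    unfolding bij_betw_same_card[OF bij_betw_insert_arc, symmetric]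
    by (subst card_SigmaI) (simp_all add: finite_matchings_no_left_nesting)
  then show ?case by (simp add: Suc.IH)
qed

lemma card_inversion_tables: "card (inversion_tables n) = fact n"
proof -
  have "card (inversion_tables n) = (\<Prod>i\<in>{1..n}. card {0..i - 1})"
    unfolding inversion_tables_def by (rule card_PiE) simp
  also have "\<dots> = \<Prod>{1..n}" by (intro prod.cong) auto
  finally show ?thesis by (simp add: fact_prod)
qed

theorem theorem1:
  fixes n :: nat
  shows "(\<exists>f. bij_betw f (matchings_no_left_nesting n) (inversion_tables n)) \<and>
    card (matchings_no_left_nesting n) = fact n"
proof
  have "finite (inversion_tables n)"
    unfolding inversion_tables_def by (intro finite_PiE) auto
  then show "\<exists>f. bij_betw f (matchings_no_left_nesting n) (inversion_tables n)"
    by (intro finite_same_card_bij finite_matchings_no_left_nesting)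
      (simp_all add: card_matchings_no_left_nesting card_inversion_tables)
qed (rule card_matchings_no_left_nesting)

end
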